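(* Let (Flow-Cov) and its alternative version be the mixed-integer programs defined in the context. Let $P$ be any set of pairs $(i,j)$, $i,j\in V$, $i<j$, each of which satisfies at least one of the following four conditions: (i) $d(i,j)>R+\sum_{e\in E}u_e$; (ii) $d(i,j,u)>R$, where $d(i,j,u)$ is the length of a shortest path from $i$ to $j$ in the graph with edge lengths $\ell_e-u_e$, $e\in E$; (iii) $\displaystyle d(i,j)>R+\sum_{k=1}^{\bar k}u_{e_{\sigma(k)}}+\frac{B-\sum_{k=1}^{\bar k}c_{e_{\sigma(k)}}u_{e_{\sigma(k)}}}{c_{e_{\sigma(\bar k+1)}}}$, where $E=\{e_1,\dots,e_m\}$, $\sigma$ is a permutation of $\{1,\dots,m\}$ with $c_{e_{\sigma(1)}}\le\dots\le c_{e_{\sigma(m)}}$, and $\bar k$ is the largest index $k$ with $\sum_{h=1}^{k}u_{e_{\sigma(h)}}c_{e_{\sigma(h)}}\le B$ (if $\bar k=m$, the last fraction is omitted); (iv) the optimal value of the following problem is greater than $R$: minimize $\sum_{a\in A}(f_a\ell_{e_a}-\gamma_a)$ over $f,\gamma,\delta$ subject to $\sum_{e\in E}c_e\delta_e\le B$; $0\le\delta_e\le u_e$ for $e\in E$; $\sum_{a\in\Gamma_k^+}f_a-\sum_{a\in\Gamma_k^-}f_a=g_k$ for $k\in V$; $\gamma_a\le u_{e_a}f_a$, $\gamma_a\le\delta_{e_a}$ and $f_a\in\{0,1\}$ for $a\in A$, where $g_i=1$, $g_j=-1$ and $g_k=0$ for $k\ne i,j$. Then, for the pairs $(i,j)\in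 P$, the variables $y_{ij},y_{ji}$, $f_a^{ij}$ and $\alpha_a^{ij}$ (respectively $\gamma_a^{ij}$), $a\in A_{ij}$, can be removed from the original (respectively alternative) (Flow-Cov) formulation, and the constraints associated with these pairs can be deleted: the program obtained by dropping $y_{ij}$ and $y_{ji}$ from the objective and from the constraints $\sum_{j'\in V\setminus\{i'\}}y_{i'j'}+x_{i'}\le 1$, deleting $y_{ij}\le x_j$, $y_{ji}\le x_i$ and the binary constraints on $y_{ij},y_{ji}$, and deleting all pair constraints of $(i,j)$, for all $(i,j)\in P$, has the same optimal value.
   Context: Setting. $N=(V,E,\ell)$ is an undirected network with $V=\{1,\dots,n\}$, $|E|=m$; each edge $e=[k,q]=[q,k]\in E$ is an unordered pair of distinct nodes with length $\ell_e>0$, maximal length reduction $u_e\in[0,\ell_e)$ and unit reduction cost $c_e\ge 0$. Given are a coverage radius $R>0$, a budget $B\ge 0$, a number of facilities $p\in\mathbb N$, and demands $w_i\ge 0$, $i\in V$. Standing assumptions: $\ell_e-u_e\le R$ and $c_eu_e\le B$ for all $e\in E$. $d(i,j)$ is the length of a shortest path between $i$ and $j$ with respect to the (non-reduced) lengths $\ell$. Distances between nodes not joined by a path, and minima of infeasible problems, are $+\infty$. Let $A$ be the arc set containing both arcs $(i,j)$ and $(j,i)$ for each $[i,j]\in E$; for $a\in A$, $e_a\in E$ is its underlying edge; $\Gamma_i^+$ (resp. $\Gamma_i^-$) is the set of arcs of $A$ leaving (resp. entering) node $i$. For $i<j$ put $A_{ij}=A\setminus(\Gamma_i^-\cup\Gamma_j^+)$.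 (Flow-Cov), original version, has variables $x_j$ ($j\in V$), $y_{ij}$ ($i\ne j$), $\delta_e$ ($e\in E$), $f_a^{ij}$ and $\alpha_a^{ij}$ ($i<j$, $a\in A_{ij}$), and reads: maximize $\sum_{i\in V}w_i\big(\sum_{j\in V\setminus\{i\}}y_{ij}+x_i\big)$ subject to Base constraints: $\sum_{j\in V}x_j=p$; $\sum_{j\in V\setminus\{i\}}y_{ij}+x_i\le 1$ for $i\in V$; $y_{ij}\le x_j$ for $i\neq j$; $\sum_{e\in E}c_e\delta_e\le B$; $0\le\delta_e\le u_e$ for $e\in E$; $x_j\in\{0,1\}$ for $j\in V$; $y_{ij}\in\{0,1\}$ for $i\ne j$. Pair constraints, for each pair $i<j$: - $\sum_{a\in A_{ij}}\alpha_a^{ij}\le R$; - $\alpha_a^{ij}\ge f_a^{ij}\ell_{e_a}-\delta_{e_a}$ for $a\in A_{ij}$; - $0\le\alpha_a^{ij}\le\ell_{e_a}-\delta_{e_a}$ for $a\in A_{ij}$; - $\sum_{a\in\Gamma_k^+,\,a\notin\Gamma_i^-}f_a^{ij}-\sum_{a\in\Gamma_k^-,\,a\notin\Gamma_j^+}f_a^{ij}=0$ for $k\in V\setminus\{i,j\}$; - $\sum_{a\in\Gamma_i^+}f_a^{ij}=y_{ij}+y_{ji}$ and $\sum_{a\in\Gamma_j^-}f_a^{ij}=y_{ij}+y_{ji}$ (sums over arcs in $A_{ij}$); - $f_a^{ij}\in\{0,1\}$ for $a\in A_{ij}$. The alternative version has variables $\gamma_a^{ij}$ instead of $\alpha_a^{ij}$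 and is obtained by replacing the first three pair constraints by: $\sum_{a\in A_{ij}}(f_a^{ij}\ell_{e_a}-\gamma_a^{ij})\le R$; $\gamma_a^{ij}\le u_{e_a}f_a^{ij}$ for $a\in A_{ij}$; $0\le\gamma_a^{ij}\le\delta_{e_a}$ for $a\in A_{ij}$. *)

theory Defs
  imports
    Complex_Main
    "HOL-Library.Extended_Real"
    "HOL-Combinatorics.Permutations"
    "Graph_Theory.Shortest_Path"
begin

record network =
  num_nodes :: nat
  edges :: "nat set set"
  len :: "nat set \<Rightarrow> real"
  max_red :: "nat set \<Rightarrow> real"
  cost :: "nat set \<Rightarrow> real"
  radius :: real
  budget :: real
  num_fac :: nat
  demand :: "nat \<Rightarrow> real"

definition nodes :: "network \<Rightarrow> nat set" where
  "nodes N = {1..num_nodes N}"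

definition valid_network :: "network \<Rightarrow> bool" where
  "valid_network N \<longleftrightarrow>
     (\<forall>e\<in>edges N. \<exists>k\<in>nodes N. \<exists>q\<in>nodes N. k \<noteq> q \<and> e = {k, q}) \<and>
     (\<forall>e\<in>edges N. len N e > 0 \<and> 0 \<le> max_red N e \<and> max_red N e < len N e \<and> cost N e \<ge> 0) \<and>
     radius N > 0 \<and> budget N \<ge> 0 \<and>
     (\<forall>i\<in>nodes N. demand N i \<ge> 0) \<and>
     (\<forall>e\<in>edges N. len N e - max_red N e \<le> radius N \<and> cost N e * max_red N e \<le> budget N)"

definition und :: "nat \<times> nat \<Rightarrow> nat set" where
  "und a = {fst a, snd a}"

text \<open>The bidirected digraph of the network: its arc set is \<open>A\<close>, and \<open>\<Gamma>\<^sub>i\<^sup>+\<close>, \<open>\<Gamma>\<^sub>i\<^sup>-\<close> are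
  \<^const>\<open>out_arcs\<close> and \<^const>\<open>in_arcs\<close>.\<close>

definition digr :: "network \<Rightarrow> (nat, nat \<times> nat) pre_digraph" where
  "digr N = \<lparr> verts = nodes N, arcs = {a. und a \<in> edges N}, tail = fst, head = snd \<rparr>"

text \<open>Shortest-path length for edge lengths \<open>l\<close>. The library's \<open>\<mu>\<close> is the infimum of the walk
  lengths; it is \<open>\<infinity>\<close> if there is no walk, and for nonnegative lengths it is attained by a path.\<close>

definition distance :: "network \<Rightarrow> (nat set \<Rightarrow> real) \<Rightarrow> nat \<Rightarrow> nat \<Rightarrow> ereal" where
  "distance N l i j = wf_digraph.\<mu> (digr N) (\<lambda>a. l (und a)) i j"

definition pair_arcs :: "network \<Rightarrow> nat \<Rightarrow> nat \<Rightarrow> (nat \<times> nat) set" where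
  "pair_arcs N i j = arcs (digr N) - (in_arcs (digr N) i \<union> out_arcs (digr N) j)"

text \<open>All programs are parametrised by the set \<open>P\<close> of pairs \<open>(i, j)\<close>, \<open>i < j\<close>, that are removed;
  \<open>P = {}\<close> gives the full formulation. The values of the solution functions at removed or
  otherwise meaningless indices occur neither in the objective nor in any constraint.\<close>

definition y_index :: "network \<Rightarrow> (nat \<times> nat) set \<Rightarrow> (nat \<times> nat) set" where
  "y_index N P =
     {(i, j). i \<in> nodes N \<and> j \<in> nodes N \<and> i \<noteq> j \<and> (i, j) \<notin> P \<and> (j, i) \<notin> P}"

definition pair_index :: "network \<Rightarrow> (nat \<times> nat) set \<Rightarrow> (nat \<times> nat) set" where
  "pair_index N P = {(i, j). i \<in> nodes N \<and> j \<in> nodes N \<and> i < j \<and> (i, j) \<notin> P}"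

definition covered ::
  "network \<Rightarrow> (nat \<times> nat) set \<Rightarrow> (nat \<Rightarrow> real) \<Rightarrow> (nat \<Rightarrow> nat \<Rightarrow> real) \<Rightarrow> nat \<Rightarrow> real" where
  "covered N P x y i = (\<Sum>j | (i, j) \<in> y_index N P. y i j) + x i"

definition objective ::
  "network \<Rightarrow> (nat \<times> nat) set \<Rightarrow> (nat \<Rightarrow> real) \<Rightarrow> (nat \<Rightarrow> nat \<Rightarrow> real) \<Rightarrow> real" where
  "objective N P x y = (\<Sum>i\<in>nodes N. demand N i * covered N P x y i)"

definition red_feasible :: "network \<Rightarrow> (nat set \<Rightarrow> real) \<Rightarrow> bool" where
  "red_feasible N \<delta> \<longleftrightarrow>
     (\<Sum>e\<in>edges N. cost N e * \<delta> e) \<le> budget N \<and>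
     (\<forall>e\<in>edges N. 0 \<le> \<delta> e \<and> \<delta> e \<le> max_red N e)"

definition base_constraints ::
  "network \<Rightarrow> (nat \<times> nat) set \<Rightarrow> (nat \<Rightarrow> real) \<Rightarrow> (nat \<Rightarrow> nat \<Rightarrow> real) \<Rightarrow> (nat set \<Rightarrow> real) \<Rightarrow> bool"
  where
  "base_constraints N P x y \<delta> \<longleftrightarrow>
     (\<Sum>j\<in>nodes N. x j) = real (num_fac N) \<and>
     (\<forall>i\<in>nodes N. covered N P x y i \<le> 1) \<and>
     (\<forall>(i, j)\<in>y_index N P. y i j \<le> x j) \<and>
     red_feasible N \<delta> \<and>
     (\<forall>j\<in>nodes N. x j \<in> {0, 1}) \<and>
     (\<forall>(i, j)\<in>y_index N P. y i j \<in> {0, 1})"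

definition flow_constraints ::
  "network \<Rightarrow> (nat \<Rightarrow> nat \<Rightarrow> real) \<Rightarrow> nat \<Rightarrow> nat \<Rightarrow> (nat \<times> nat \<Rightarrow> real) \<Rightarrow> bool" where
  "flow_constraints N y i j f \<longleftrightarrow>
     (\<forall>k\<in>nodes N - {i, j}.
        (\<Sum>a\<in>out_arcs (digr N) k - in_arcs (digr N) i. f a)
      - (\<Sum>a\<in>in_arcs (digr N) k - out_arcs (digr N) j. f a) = 0) \<and>
     (\<Sum>a\<in>out_arcs (digr N) i \<inter> pair_arcs N i j. f a) = y i j + y j i \<and>
     (\<Sum>a\<in>in_arcs (digr N) j \<inter> pair_arcs N i j. f a) = y i j + y j i \<and>
     (\<forall>a\<in>pair_arcs N i j. f a \<in> {0, 1})"

definition orig_length_constraints ::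
  "network \<Rightarrow> (nat set \<Rightarrow> real) \<Rightarrow> nat \<Rightarrow> nat \<Rightarrow> (nat \<times> nat \<Rightarrow> real) \<Rightarrow> (nat \<times> nat \<Rightarrow> real) \<Rightarrow> bool"
  where
  "orig_length_constraints N \<delta> i j f \<alpha> \<longleftrightarrow>
     (\<Sum>a\<in>pair_arcs N i j. \<alpha> a) \<le> radius N \<and>
     (\<forall>a\<in>pair_arcs N i j. \<alpha> a \<ge> f a * len N (und a) - \<delta> (und a)) \<and>
     (\<forall>a\<in>pair_arcs N i j. 0 \<le> \<alpha> a \<and> \<alpha> a \<le> len N (und a) - \<delta> (und a))"

definition alt_length_constraints ::
  "network \<Rightarrow> (nat set \<Rightarrow> real) \<Rightarrow> nat \<Rightarrow> nat \<Rightarrow> (nat \<times> nat \<Rightarrow> real) \<Rightarrow> (nat \<times> nat \<Rightarrow> real) \<Rightarrow> bool"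
  where
  "alt_length_constraints N \<delta> i j f \<gamma> \<longleftrightarrow>
     (\<Sum>a\<in>pair_arcs N i j. f a * len N (und a) - \<gamma> a) \<le> radius N \<and>
     (\<forall>a\<in>pair_arcs N i j. \<gamma> a \<le> max_red N (und a) * f a) \<and>
     (\<forall>a\<in>pair_arcs N i j. 0 \<le> \<gamma> a \<and> \<gamma> a \<le> \<delta> (und a))"

definition flow_cov_feasible ::
  "network \<Rightarrow> (nat \<times> nat) set \<Rightarrow> (nat \<Rightarrow> real) \<Rightarrow> (nat \<Rightarrow> nat \<Rightarrow> real) \<Rightarrow> (nat set \<Rightarrow> real) \<Rightarrow>
   (nat \<Rightarrow> nat \<Rightarrow> nat \<times> nat \<Rightarrow> real) \<Rightarrow> (nat \<Rightarrow> nat \<Rightarrow> nat \<times> nat \<Rightarrow> real) \<Rightarrow> bool" where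
  "flow_cov_feasible N P x y \<delta> f \<alpha> \<longleftrightarrow>
     base_constraints N P x y \<delta> \<and>
     (\<forall>(i, j)\<in>pair_index N P.
        orig_length_constraints N \<delta> i j (f i j) (\<alpha> i j) \<and> flow_constraints N y i j (f i j))"

definition alt_flow_cov_feasible ::
  "network \<Rightarrow> (nat \<times> nat) set \<Rightarrow> (nat \<Rightarrow> real) \<Rightarrow> (nat \<Rightarrow> nat \<Rightarrow> real) \<Rightarrow> (nat set \<Rightarrow> real) \<Rightarrow>
   (nat \<Rightarrow> nat \<Rightarrow> nat \<times> nat \<Rightarrow> real) \<Rightarrow> (nat \<Rightarrow> nat \<Rightarrow> nat \<times> nat \<Rightarrow> real) \<Rightarrow> bool" where
  "alt_flow_cov_feasible N P x y \<delta> f \<gamma> \<longleftrightarrow>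
     base_constraints N P x y \<delta> \<and>
     (\<forall>(i, j)\<in>pair_index N P.
        alt_length_constraints N \<delta> i j (f i j) (\<gamma> i j) \<and> flow_constraints N y i j (f i j))"

text \<open>Optimal values live in \<^typ>\<open>ereal\<close>: an infeasible maximisation problem has value \<open>-\<infinity>\<close>,
  an infeasible minimisation problem has value \<open>\<infinity>\<close>.\<close>

definition flow_cov_value :: "network \<Rightarrow> (nat \<times> nat) set \<Rightarrow> ereal" where
  "flow_cov_value N P =
     Sup {ereal (objective N P x y) | x y \<delta> f \<alpha>. flow_cov_feasible N P x y \<delta> f \<alpha>}"

definition alt_flow_cov_value :: "network \<Rightarrow> (nat \<times> nat) set \<Rightarrow> ereal" where
  "alt_flow_cov_value N P =
     Sup {ereal (objective N P x y) | x y \<delta> f \<gamma>. alt_flow_cov_feasible N P x y \<delta> f \<gamma>}"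

definition cond_i :: "network \<Rightarrow> nat \<Rightarrow> nat \<Rightarrow> bool" where
  "cond_i N i j \<longleftrightarrow>
     distance N (len N) i j > ereal (radius N + (\<Sum>e\<in>edges N. max_red N e))"

definition cond_ii :: "network \<Rightarrow> nat \<Rightarrow> nat \<Rightarrow> bool" where
  "cond_ii N i j \<longleftrightarrow>
     distance N (\<lambda>e. len N e - max_red N e) i j > ereal (radius N)"

text \<open>Below, \<open>es 1, \<dots>, es m\<close> is an enumeration of the edges, and \<open>\<sigma>\<close> sorts it by cost.\<close>

definition k_bar :: "network \<Rightarrow> (nat \<Rightarrow> nat set) \<Rightarrow> (nat \<Rightarrow> nat) \<Rightarrow> nat" where
  "k_bar N es \<sigma> =
     Max {k \<in> {0..card (edges N)}.
            (\<Sum>h=1..k. max_red N (es (\<sigma> h)) * cost N (es (\<sigma> h))) \<le> budget N}"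

definition cond_iii :: "network \<Rightarrow> (nat \<Rightarrow> nat set) \<Rightarrow> (nat \<Rightarrow> nat) \<Rightarrow> nat \<Rightarrow> nat \<Rightarrow> bool" where
  "cond_iii N es \<sigma> i j \<longleftrightarrow>
     (let K = k_bar N es \<sigma> in
      distance N (len N) i j >
        ereal (radius N + (\<Sum>k=1..K. max_red N (es (\<sigma> k)))
          + (if K = card (edges N) then 0
             else (budget N - (\<Sum>k=1..K. cost N (es (\<sigma> k)) * max_red N (es (\<sigma> k))))
                    / cost N (es (\<sigma> (K + 1))))))"

definition iv_feasible ::
  "network \<Rightarrow> nat \<Rightarrow> nat \<Rightarrow> (nat \<times> nat \<Rightarrow> real) \<Rightarrow> (nat \<times> nat \<Rightarrow> real) \<Rightarrow> (nat set \<Rightarrow> real) \<Rightarrow> bool"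
  where
  "iv_feasible N i j f \<gamma> \<delta> \<longleftrightarrow>
     red_feasible N \<delta> \<and>
     (\<forall>k\<in>nodes N. (\<Sum>a\<in>out_arcs (digr N) k. f a) - (\<Sum>a\<in>in_arcs (digr N) k. f a)
        = (if k = i then 1 else if k = j then - 1 else 0)) \<and>
     (\<forall>a\<in>arcs (digr N).
        \<gamma> a \<le> max_red N (und a) * f a \<and> \<gamma> a \<le> \<delta> (und a) \<and> f a \<in> {0, 1})"

definition iv_value :: "network \<Rightarrow> nat \<Rightarrow> nat \<Rightarrow> ereal" where
  "iv_value N i j =
     Inf {ereal (\<Sum>a\<in>arcs (digr N). f a * len N (und a) - \<gamma> a) | f \<gamma> \<delta>. iv_feasible N i j f \<gamma> \<delta>}"

definition cond_iv :: "network \<Rightarrow> nat \<Rightarrow> nat \<Rightarrow> bool" where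
  "cond_iv N i j \<longleftrightarrow> iv_value N i j > ereal (radius N)"

end

theory Submission
  imports Defs
begin

text \<open>
  A removed pair \<open>(i, j)\<close> cannot serve anybody: every feasible solution of the full program has
  \<open>y\<^sub>i\<^sub>j = y\<^sub>j\<^sub>i = 0\<close>. Dropping these variables therefore costs nothing, and conversely a solution of
  the reduced program extends by zeros. So the two programs attain exactly the same objective values
  (\<open>removal_preserves_objective_values\<close>), not only the same supremum.

  To see that the variables vanish, suppose one of them is \<open>1\<close>. Then a facility stands at the node
  named by its second index; that node is covered by itself and cannot be assigned elsewhere, so
  \<open>y\<^sub>i\<^sub>j + y\<^sub>j\<^sub>i = 1\<close> (\<open>base_constraints_not_mutual\<close>). The pair constraints now send one unit of \<open>0\<close>-\<open>1\<close> flow from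
  \<open>i\<close> to \<open>j\<close>. Both versions bound its length with respect to the reduced lengths
  \<open>\<ell>\<^sub>e - \<delta>\<^sub>e\<close> by \<open>R\<close>; the notion of a \<open>covering_flow\<close> records just this, and it is all that the
  rest of the argument uses. Such a flow contradicts each of the four conditions:
  \<^item> it is a feasible point of the minimisation problem in (iv), with \<open>\<gamma>\<^sub>a = f\<^sub>a \<delta>\<^sub>e\<close>;
  \<^item> a unit flow carries a path from \<open>i\<close> to \<open>j\<close> (\<open>unit_flow_apath\<close>), whose reduced length is at
    most \<open>R\<close>; as \<open>\<delta> \<le> u\<close>, this contradicts (ii);
  \<^item> a path uses every edge at most once, so its unreduced length is at most \<open>R + \<Sum>\<delta>\<^sub>e\<close>. The
    conditions (i) and (iii) claim a larger distance, because \<open>\<Sum>\<delta>\<^sub>e\<close> is bounded by \<open>\<Sum>u\<^sub>e\<close> and also by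
    the value of the continuous knapsack problem that spends the budget on the cheapest edges
    first (\<open>fractional_knapsack_bound\<close>).
\<close>

section \<open>Unit flows carry paths\<close>

text \<open>
  Flow decomposition is avoided by a cut argument. Let \<open>S\<close> be the set of vertices that can be reached
  from \<open>i\<close> along arcs of positive flow. No flow leaves \<open>S\<close>, so the net outflow of \<open>S\<close> is not
  positive. But if \<open>j\<close> were outside \<open>S\<close>, the source \<open>i\<close> would make it \<open>1\<close>.
\<close>

lemma (in fin_digraph) unit_flow_apath:
  fixes f :: "'b \<Rightarrow> real"
  assumes nonneg: "\<And>a. a \<in> arcs G \<Longrightarrow> 0 \<le> f a"
    and net: "\<And>k. k \<in> verts G \<Longrightarrow>
      (\<Sum>a\<in>out_arcs G k. f a) - (\<Sum>a\<in>in_arcs G k. f a)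
        = (if k = i then 1 else if k = j then - 1 else 0)"
    and i: "i \<in> verts G"
  obtains p where "apath i p j" "\<And>a. a \<in> set p \<Longrightarrow> 0 < f a"
proof -
  define S where "S = {v. \<exists>p. awalk i p v \<and> (\<forall>a\<in>set p. 0 < f a)}"
  have S_sub: "S \<subseteq> verts G"
    unfolding S_def using awalk_last_in_verts by blast
  then have fin: "finite S"
    by (rule finite_subset) simp
  have "i \<in> S"
    unfolding S_def using i by (auto intro!: exI[of _ "[]"] simp: awalk_Nil_iff)
  have step: "head G a \<in> S" if "a \<in> arcs G" "tail G a \<in> S" "0 < f a" for a
  proof -
    from that(2) obtain p where "awalk i p (tail G a)" "\<forall>b\<in>set p. 0 < f b"
      unfolding S_def by blast
    with that have "awalk i (p @ [a]) (head G a)" "\<forall>b\<in>set (p @ [a]). 0 < f b"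
      by (auto intro!: awalk_appendI arc_implies_awalk simp: arc_def)
    then show ?thesis
      unfolding S_def by blast
  qed
  have "j \<in> S"
  proof (rule ccontr)
    assume j: "j \<notin> S"
    let ?T = "{a \<in> arcs G. tail G a \<in> S}" and ?H = "{a \<in> arcs G. head G a \<in> S}"
    have "(\<Sum>k\<in>S. \<Sum>a\<in>out_arcs G k. f a) = (\<Sum>k\<in>S. \<Sum>a\<in>{a \<in> ?T. tail G a = k}. f a)"
      by (intro sum.cong) (auto simp: out_arcs_def)
    also have "\<dots> = sum f ?T"
      using fin by (intro sum.group) auto
    finally have outflow: "(\<Sum>k\<in>S. \<Sum>a\<in>out_arcs G k. f a) = sum f ?T" .
    have "(\<Sum>k\<in>S. \<Sum>a\<in>in_arcs G k. f a) = (\<Sum>k\<in>S. \<Sum>a\<in>{a \<in> ?H. head G a = k}. f a)"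
      by (intro sum.cong) (auto simp: in_arcs_def)
    also have "\<dots> = sum f ?H"
      using fin by (intro sum.group) auto
    finally have inflow: "(\<Sum>k\<in>S. \<Sum>a\<in>in_arcs G k. f a) = sum f ?H" .
    have "sum f ?T = sum f {a \<in> ?T. 0 < f a}"
      by (intro sum.mono_neutral_right) (auto simp: not_less intro: antisym nonneg)
    also have "\<dots> \<le> sum f ?H"
      using step nonneg by (intro sum_mono2) auto
    finally have "sum f ?T - sum f ?H \<le> 0"
      by simp
    moreover have "sum f ?T - sum f ?H = (\<Sum>k\<in>S. if k = i then 1 else if k = j then - 1 else 0)"
      unfolding outflow[symmetric] inflow[symmetric] sum_subtractf[symmetric]
      using S_sub by (intro sum.cong net) auto
    moreover have "\<dots> = (\<Sum>k\<in>S. if k = i then 1 else (0 :: real))"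
      using j by (intro sum.cong) auto
    moreover have "\<dots> = 1"
      using fin \<open>i \<in> S\<close> by simp
    ultimately show False
      by simp
  qed
  then obtain p where p: "awalk i p j" "\<forall>a\<in>set p. 0 < f a"
    unfolding S_def by blast
  show thesis
  proof (rule that)
    show "apath i (awalk_to_apath p) j"
      using p(1) by (rule apath_awalk_to_apath)
    show "0 < f a" if "a \<in> set (awalk_to_apath p)" for a
      using p awalk_to_apath_subset[OF p(1)] that by blast
  qed
qed

section \<open>The bidirected digraph of a network\<close>

lemma finite_nodes: "finite (nodes N)"
  by (simp add: nodes_def)

lemma edge_subset_nodes:
  assumes "valid_network N" "e \<in> edges N"
  shows "e \<subseteq> nodes N"
proof -
  obtain k q where "k \<in> nodes N" "q \<in> nodes N" "e = {k, q}"
    using assms by (meson valid_network_def)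
  then show ?thesis
    by simp
qed

lemma finite_edges:
  assumes "valid_network N"
  shows "finite (edges N)"
proof (rule finite_subset)
  show "edges N \<subseteq> Pow (nodes N)"
    using edge_subset_nodes[OF assms] by blast
qed (simp add: finite_nodes)

lemma verts_digr [simp]: "verts (digr N) = nodes N"
  and tail_digr [simp]: "tail (digr N) = fst"
  and head_digr [simp]: "head (digr N) = snd"
  and arcs_digr: "arcs (digr N) = {a. und a \<in> edges N}"
  by (simp_all add: digr_def)

lemma und_in_edges: "a \<in> arcs (digr N) \<Longrightarrow> und a \<in> edges N"
  by (simp add: arcs_digr)

lemma fin_digraph_digr:
  assumes "valid_network N"
  shows "fin_digraph (digr N)"
proof -
  have ends: "fst a \<in> nodes N \<and> snd a \<in> nodes N" if "a \<in> arcs (digr N)" for a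
    using edge_subset_nodes[OF assms und_in_edges[OF that]] by (simp add: und_def)
  then have "arcs (digr N) \<subseteq> nodes N \<times> nodes N"
    by (auto simp: mem_Times_iff)
  then have "finite (arcs (digr N))"
    by (rule finite_subset) (simp add: finite_nodes)
  with ends show ?thesis
    by unfold_locales (auto simp: finite_nodes)
qed

text \<open>
  A path may not use both arcs of an edge, because the first one of them to be used leaves a vertex
  that the rest of the path avoids.
\<close>

lemma apath_distinct_edges:
  assumes "valid_network N" "pre_digraph.apath (digr N) i p j"
  shows "distinct (map und p)"
proof -
  interpret fin_digraph "digr N"
    by (rule fin_digraph_digr) fact
  show ?thesis
    using assms(2)
  proof (induction p arbitrary: i)
    case (Cons a p)
    then have a: "fst a = i" and p: "apath (snd a) p j"
      and i: "i \<notin> set (awalk_verts (snd a) p)"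
      by (auto simp: apath_Cons_iff)
    have "und a \<noteq> und b" if "b \<in> set p" for b
    proof
      assume "und a = und b"
      then have "i = fst b \<or> i = snd b"
        using a by (auto simp: und_def)
      moreover have "fst b \<in> set (awalk_verts (snd a) p)" "snd b \<in> set (awalk_verts (snd a) p)"
        using awalk_verts_arc1[OF that] awalk_verts_arc2[OF awalkI_apath[OF p] that] by simp_all
      ultimately show False
        using i by blast
    qed
    with Cons.IH[OF p] show ?case
      by auto
  qed simp
qed

lemma distance_le_apath:
  assumes "valid_network N" "pre_digraph.apath (digr N) i p j"
  shows "distance N l i j \<le> ereal (\<Sum>a\<in>set p. l (und a))"
proof -
  interpret fin_digraph "digr N"
    by (rule fin_digraph_digr) fact
  have "distinct p"
    using apath_distinct_edges[OF assms] by (simp add: distinct_map)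
  then have "awalk_cost (\<lambda>a. l (und a)) p = (\<Sum>a\<in>set p. l (und a))"
    by (simp add: awalk_cost_def sum_list_distinct_conv_sum_set)
  with min_cost_le_walk_cost[OF awalkI_apath[OF assms(2)]] show ?thesis
    unfolding distance_def by metis
qed

section \<open>Flows of bounded reduced length\<close>

definition unit_flow :: "network \<Rightarrow> nat \<Rightarrow> nat \<Rightarrow> (nat \<times> nat \<Rightarrow> real) \<Rightarrow> bool" where
  "unit_flow N i j f \<longleftrightarrow>
     (\<forall>k\<in>nodes N. (\<Sum>a\<in>out_arcs (digr N) k. f a) - (\<Sum>a\<in>in_arcs (digr N) k. f a)
        = (if k = i then 1 else if k = j then - 1 else 0)) \<and>
     (\<forall>a\<in>arcs (digr N). f a \<in> {0, 1})"

text \<open>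
  The common consequence of the original and the alternative pair constraints when \<open>i\<close> covers \<open>j\<close>
  or \<open>j\<close> covers \<open>i\<close>.
\<close>

definition covering_flow ::
  "network \<Rightarrow> (nat set \<Rightarrow> real) \<Rightarrow> nat \<Rightarrow> nat \<Rightarrow> (nat \<times> nat \<Rightarrow> real) \<Rightarrow> bool" where
  "covering_flow N \<delta> i j f \<longleftrightarrow>
     unit_flow N i j f \<and>
     (\<Sum>a\<in>arcs (digr N). f a * (len N (und a) - \<delta> (und a))) \<le> radius N"

lemma reduced_length_pos:
  assumes "valid_network N" "red_feasible N \<delta>" "a \<in> arcs (digr N)"
  shows "0 < len N (und a) - \<delta> (und a)"
proof -
  have "max_red N (und a) < len N (und a)"
    using assms(1) und_in_edges[OF assms(3)] by (simp add: valid_network_def)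
  moreover have "\<delta> (und a) \<le> max_red N (und a)"
    using assms(2) und_in_edges[OF assms(3)] by (simp add: red_feasible_def)
  ultimately show ?thesis
    by simp
qed

text \<open>
  Reduced lengths are positive, so the path carried by the flow is no longer than the flow.
\<close>

lemma covering_flow_apath:
  assumes N: "valid_network N" and \<delta>: "red_feasible N \<delta>"
    and f: "covering_flow N \<delta> i j f" and i: "i \<in> nodes N"
  obtains p where "pre_digraph.apath (digr N) i p j"
    "(\<Sum>a\<in>set p. len N (und a) - \<delta> (und a)) \<le> radius N"
proof -
  interpret fin_digraph "digr N"
    by (rule fin_digraph_digr) fact
  have f01: "f a = 0 \<or> f a = 1" if "a \<in> arcs (digr N)" for a
    using f that by (auto simp: covering_flow_def unit_flow_def)
  have f_nonneg: "0 \<le> f a" if "a \<in> arcs (digr N)" for a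
    using f01[OF that] by auto
  obtain p where p: "apath i p j" and pos: "\<And>a. a \<in> set p \<Longrightarrow> 0 < f a"
  proof (rule unit_flow_apath[of f i j])
    show "(\<Sum>a\<in>out_arcs (digr N) k. f a) - (\<Sum>a\<in>in_arcs (digr N) k. f a)
        = (if k = i then 1 else if k = j then - 1 else 0)" if "k \<in> verts (digr N)" for k
      using f that by (simp add: covering_flow_def unit_flow_def)
  qed (use f_nonneg i in auto)
  have sub: "set p \<subseteq> arcs (digr N)"
    using p by (auto simp: apath_def)
  have "(\<Sum>a\<in>set p. len N (und a) - \<delta> (und a))
      = (\<Sum>a\<in>set p. f a * (len N (und a) - \<delta> (und a)))"
    using pos f01 sub by (intro sum.cong refl) (metis less_irrefl mult_1 subsetD)
  also have "\<dots> \<le> (\<Sum>a\<in>arcs (digr N). f a * (len N (und a) - \<delta> (und a)))"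
    using sub by (intro sum_mono2 mult_nonneg_nonneg f_nonneg
        less_imp_le[OF reduced_length_pos[OF N \<delta>]]) auto
  also have "\<dots> \<le> radius N"
    using f by (simp add: covering_flow_def)
  finally show thesis
    using p that by blast
qed

section \<open>A covering flow contradicts each of the conditions\<close>

lemma not_cond_ii:
  assumes "valid_network N" "red_feasible N \<delta>" "covering_flow N \<delta> i j f" "i \<in> nodes N"
  shows "\<not> cond_ii N i j"
proof -
  obtain p where p: "pre_digraph.apath (digr N) i p j"
    and le: "(\<Sum>a\<in>set p. len N (und a) - \<delta> (und a)) \<le> radius N"
    using covering_flow_apath[OF assms] .
  interpret fin_digraph "digr N"
    by (rule fin_digraph_digr) fact
  have "set p \<subseteq> arcs (digr N)"
    using p by (auto simp: apath_def)
  then have "(\<Sum>a\<in>set p. len N (und a) - max_red N (und a))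
      \<le> (\<Sum>a\<in>set p. len N (und a) - \<delta> (und a))"
    using assms(2) und_in_edges by (intro sum_mono) (force simp: red_feasible_def)
  with distance_le_apath[OF assms(1) p, of "\<lambda>e. len N e - max_red N e"] le
  have "distance N (\<lambda>e. len N e - max_red N e) i j \<le> ereal (radius N)"
    by (auto elim!: order_trans)
  then show ?thesis
    by (simp add: cond_ii_def not_less)
qed

text \<open>
  Each edge of the path is shortened only once, hence the reductions along the path add up to at most
  \<open>\<Sum>\<delta>\<^sub>e\<close>.
\<close>

lemma distance_le_total_reduction:
  assumes N: "valid_network N" and \<delta>: "red_feasible N \<delta>"
    and f: "covering_flow N \<delta> i j f" and i: "i \<in> nodes N"
  shows "distance N (len N) i j \<le> ereal (radius N + (\<Sum>e\<in>edges N. \<delta> e))"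
proof -
  obtain p where p: "pre_digraph.apath (digr N) i p j"
    and le: "(\<Sum>a\<in>set p. len N (und a) - \<delta> (und a)) \<le> radius N"
    using covering_flow_apath[OF assms] .
  interpret fin_digraph "digr N"
    by (rule fin_digraph_digr) fact
  have sub: "und ` set p \<subseteq> edges N"
    using p und_in_edges by (force simp: apath_def)
  have "inj_on und (set p)"
    using apath_distinct_edges[OF N p] by (simp add: distinct_map)
  then have "(\<Sum>a\<in>set p. \<delta> (und a)) = (\<Sum>e\<in>und ` set p. \<delta> e)"
    by (simp add: sum.reindex)
  also have "\<dots> \<le> (\<Sum>e\<in>edges N. \<delta> e)"
    using sub \<delta> finite_edges[OF N] by (intro sum_mono2) (auto simp: red_feasible_def)
  finally have "(\<Sum>a\<in>set p. len N (und a)) \<le> radius N + (\<Sum>e\<in>edges N. \<delta> e)"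
    using le by (simp add: sum_subtractf)
  with distance_le_apath[OF N p, of "len N"] show ?thesis
    by (auto elim!: order_trans)
qed

lemma not_cond_i:
  assumes "valid_network N" "red_feasible N \<delta>" "covering_flow N \<delta> i j f" "i \<in> nodes N"
  shows "\<not> cond_i N i j"
proof -
  have "(\<Sum>e\<in>edges N. \<delta> e) \<le> (\<Sum>e\<in>edges N. max_red N e)"
    using assms(2) by (intro sum_mono) (auto simp: red_feasible_def)
  then have "ereal (radius N + (\<Sum>e\<in>edges N. \<delta> e))
      \<le> ereal (radius N + (\<Sum>e\<in>edges N. max_red N e))"
    by simp
  from order_trans[OF distance_le_total_reduction[OF assms] this] show ?thesis
    by (simp add: cond_i_def not_less)
qed

text \<open>
  Compared with the greedy solution \<open>v\<close>, which fills the items up to \<open>K\<close>, any solution \<open>d\<close> is smaller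
  on items that are at most as expensive as item \<open>K + 1\<close> and larger on items that are at least as
  expensive. In both cases charging the difference at the price of item \<open>K + 1\<close> does not exceed
  its true cost, so the total difference costs at least \<open>c\<^sub>K\<^sub>+\<^sub>1 (\<Sum>d - \<Sum>v)\<close>, while the budget left over by
  \<open>v\<close> bounds this cost.
\<close>

lemma fractional_knapsack_bound:
  fixes c u d :: "nat \<Rightarrow> real"
  assumes mono: "mono_on {1..m} c"
    and u: "\<And>k. k \<in> {1..m} \<Longrightarrow> 0 \<le> d k \<and> d k \<le> u k"
    and budget: "(\<Sum>k=1..m. c k * d k) \<le> B"
    and K: "K < m" and pos: "0 < c (K + 1)"
  shows "(\<Sum>k=1..m. d k) \<le> (\<Sum>k=1..K. u k) + (B - (\<Sum>k=1..K. c k * u k)) / c (K + 1)"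
proof -
  define v where "v k = (if k \<le> K then u k else 0)" for k
  have restrict: "(\<Sum>k=1..m. g k * v k) = (\<Sum>k=1..K. g k * u k)" for g :: "nat \<Rightarrow> real"
    using K by (intro sum.mono_neutral_cong_right) (auto simp: v_def)
  have exchange: "c (K + 1) * (d k - v k) \<le> c k * (d k - v k)" if k: "k \<in> {1..m}" for k
  proof (cases "k \<le> K")
    case True
    then have "c k \<le> c (K + 1)" "d k - v k \<le> 0"
      using mono_onD[OF mono, of k "K + 1"] K k u[OF k] by (auto simp: v_def)
    then show ?thesis
      by (rule mult_right_mono_neg)
  next
    case False
    then have "c (K + 1) \<le> c k" "0 \<le> d k - v k"
      using mono_onD[OF mono, of "K + 1" k] k u[OF k] by (auto simp: v_def)
    then show ?thesis
      by (rule mult_right_mono)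
  qed
  have "c (K + 1) * ((\<Sum>k=1..m. d k) - (\<Sum>k=1..K. u k)) = (\<Sum>k=1..m. c (K + 1) * (d k - v k))"
    using restrict[of "\<lambda>_. 1"] by (simp add: sum_distrib_left[symmetric] sum_subtractf)
  also have "\<dots> \<le> (\<Sum>k=1..m. c k * (d k - v k))"
    by (intro sum_mono exchange)
  also have "\<dots> = (\<Sum>k=1..m. c k * d k) - (\<Sum>k=1..K. c k * u k)"
    using restrict[of c] by (simp add: right_diff_distrib sum_subtractf)
  also have "\<dots> \<le> B - (\<Sum>k=1..K. c k * u k)"
    using budget by simp
  finally show ?thesis
    using pos by (simp add: field_simps)
qed

lemma not_cond_iii:
  assumes N: "valid_network N" and \<delta>: "red_feasible N \<delta>"
    and f: "covering_flow N \<delta> i j f" and i: "i \<in> nodes N"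
    and es: "bij_betw es {1..card (edges N)} (edges N)"
    and \<sigma>: "\<sigma> permutes {1..card (edges N)}"
    and sorted: "mono_on {1..card (edges N)} (\<lambda>k. cost N (es (\<sigma> k)))"
  shows "\<not> cond_iii N es \<sigma> i j"
proof -
  define m where "m = card (edges N)"
  define c where "c k = cost N (es (\<sigma> k))" for k
  define u where "u k = max_red N (es (\<sigma> k))" for k
  define d where "d k = \<delta> (es (\<sigma> k))" for k
  define K where "K = k_bar N es \<sigma>"
  have bij: "bij_betw (\<lambda>k. es (\<sigma> k)) {1..m} (edges N)"
    using bij_betw_trans[OF permutes_imp_bij[OF \<sigma>] es] by (simp add: comp_def m_def)
  then have e_in: "es (\<sigma> k) \<in> edges N" if "k \<in> {1..m}" for k
    using that by (rule bij_betw_apply)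
  have d: "0 \<le> d k \<and> d k \<le> u k" if "k \<in> {1..m}" for k
    using \<delta> e_in[OF that] by (simp add: red_feasible_def d_def u_def)
  have c_nonneg: "0 \<le> c k" if "k \<in> {1..m}" for k
    using N e_in[OF that] by (simp add: valid_network_def c_def)
  have total: "(\<Sum>e\<in>edges N. \<delta> e) = (\<Sum>k=1..m. d k)"
    using sum.reindex_bij_betw[OF bij, of \<delta>] by (simp add: d_def)
  have budget: "(\<Sum>k=1..m. c k * d k) \<le> budget N"
    using sum.reindex_bij_betw[OF bij, of "\<lambda>e. cost N e * \<delta> e"] \<delta>
    by (simp add: red_feasible_def c_def d_def)
  define Ks where "Ks = {k \<in> {0..m}. (\<Sum>h=1..k. u h * c h) \<le> budget N}"
  have K_Max: "K = Max Ks"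
    by (simp add: K_def k_bar_def Ks_def m_def u_def c_def)
  have "finite Ks"
    by (simp add: Ks_def)
  have "0 \<in> Ks"
    using N by (simp add: Ks_def valid_network_def)
  then have "K \<in> Ks"
    using Max_in[OF \<open>finite Ks\<close>] K_Max by auto
  have "(\<Sum>k=1..m. d k) \<le> (\<Sum>k=1..K. u k) +
      (if K = m then 0 else (budget N - (\<Sum>k=1..K. c k * u k)) / c (K + 1))"
  proof (cases "K = m")
    case True
    then show ?thesis
      using d by (auto intro!: sum_mono)
  next
    case False
    with \<open>K \<in> Ks\<close> have "K < m" and within: "(\<Sum>h=1..K. u h * c h) \<le> budget N"
      by (auto simp: Ks_def)
    \<comment> \<open>The divisor is nonzero: a free item would still fit into the budget.\<close>
    have "K + 1 \<notin> Ks"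
      using Max_ge[OF \<open>finite Ks\<close>, of "K + 1"] K_Max by auto
    then have "c (K + 1) \<noteq> 0"
      using \<open>K < m\<close> within by (auto simp: Ks_def)
    with c_nonneg[of "K + 1"] \<open>K < m\<close> have "0 < c (K + 1)"
      by simp
    moreover have "mono_on {1..m} c"
      using sorted by (simp add: c_def[abs_def] m_def)
    ultimately show ?thesis
      using fractional_knapsack_bound[OF _ d budget \<open>K < m\<close>] False by simp
  qed
  then have "ereal (radius N + (\<Sum>e\<in>edges N. \<delta> e)) \<le>
      ereal (radius N + (\<Sum>k=1..K. u k) +
        (if K = m then 0 else (budget N - (\<Sum>k=1..K. c k * u k)) / c (K + 1)))"
    by (simp add: total)
  from order_trans[OF distance_le_total_reduction[OF N \<delta> f i] this] show ?thesis
    unfolding cond_iii_def Let_def not_less K_def[symmetric] m_def[symmetric] c_def u_def .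
qed

lemma not_cond_iv:
  assumes N: "valid_network N" and \<delta>: "red_feasible N \<delta>" and f: "covering_flow N \<delta> i j f"
  shows "\<not> cond_iv N i j"
proof -
  define \<gamma> where "\<gamma> a = f a * \<delta> (und a)" for a
  have "iv_feasible N i j f \<gamma> \<delta>"
    unfolding iv_feasible_def
  proof (intro conjI ballI)
    fix a assume a: "a \<in> arcs (digr N)"
    show f01: "f a \<in> {0, 1}"
      using f a by (simp add: covering_flow_def unit_flow_def)
    have "0 \<le> \<delta> (und a)" "\<delta> (und a) \<le> max_red N (und a)"
      using \<delta> und_in_edges[OF a] by (auto simp: red_feasible_def)
    then show "\<gamma> a \<le> max_red N (und a) * f a" "\<gamma> a \<le> \<delta> (und a)"
      using f01 by (auto simp: \<gamma>_def)
  qed (use \<delta> f in \<open>auto simp: covering_flow_def unit_flow_def\<close>)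
  then have "iv_value N i j \<le> ereal (\<Sum>a\<in>arcs (digr N). f a * len N (und a) - \<gamma> a)"
    unfolding iv_value_def by (intro Inf_lower) blast
  also have "\<dots> \<le> ereal (radius N)"
    using f by (simp add: covering_flow_def \<gamma>_def right_diff_distrib)
  finally show ?thesis
    by (simp add: cond_iv_def not_less)
qed

section \<open>Pair constraints yield covering flows\<close>

text \<open>
  Extending the flow by zero to the arcs outside \<open>A\<^sub>i\<^sub>j\<close>, that is, to those that enter \<open>i\<close> or leave
  \<open>j\<close>, turns the conservation constraints of the pair into the balance conditions of a unit flow.
\<close>

lemma covering_flow_of_pair_flow:
  assumes N: "valid_network N" and ij: "i \<in> nodes N" "j \<in> nodes N" "i \<noteq> j"
    and flow: "flow_constraints N y i j f" and y: "y i j + y j i = 1"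
    and le: "(\<Sum>a\<in>pair_arcs N i j. f a * (len N (und a) - \<delta> (und a))) \<le> radius N"
  shows "covering_flow N \<delta> i j (\<lambda>a. if a \<in> pair_arcs N i j then f a else 0)"
proof -
  interpret fin_digraph "digr N"
    by (rule fin_digraph_digr) fact
  let ?F = "\<lambda>a. if a \<in> pair_arcs N i j then f a else 0"
  have restrict: "(\<Sum>a\<in>A. if a \<in> pair_arcs N i j then g a else 0) = (\<Sum>a\<in>A \<inter> pair_arcs N i j. g a)"
    if "finite A" for A and g :: "nat \<times> nat \<Rightarrow> real"
    using that by (simp add: sum.inter_restrict)
  have net: "(\<Sum>a\<in>out_arcs (digr N) k. ?F a) - (\<Sum>a\<in>in_arcs (digr N) k. ?F a)
        = (if k = i then 1 else if k = j then - 1 else 0)" if k: "k \<in> nodes N" for k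
  proof -
    have "out_arcs (digr N) k \<inter> pair_arcs N i j
          = (if k = j then {} else out_arcs (digr N) k - in_arcs (digr N) i)"
      "in_arcs (digr N) k \<inter> pair_arcs N i j
          = (if k = i then {} else in_arcs (digr N) k - out_arcs (digr N) j)"
      by (auto simp: pair_arcs_def)
    with flow y k ij show ?thesis
      by (auto simp: restrict finite_out_arcs finite_in_arcs flow_constraints_def)
  qed
  have "(\<Sum>a\<in>arcs (digr N). ?F a * (len N (und a) - \<delta> (und a)))
      = (\<Sum>a\<in>arcs (digr N). if a \<in> pair_arcs N i j then f a * (len N (und a) - \<delta> (und a)) else 0)"
    by (intro sum.cong) auto
  also have "\<dots> = (\<Sum>a\<in>pair_arcs N i j. f a * (len N (und a) - \<delta> (und a)))"
    by (subst restrict) (auto intro!: sum.cong simp: pair_arcs_def)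
  finally show ?thesis
    using le net flow by (auto simp: covering_flow_def unit_flow_def flow_constraints_def)
qed

text \<open>
  On arcs that carry flow, \<open>\<alpha>\<close> is at least the reduced length; on the others it is nonnegative.
\<close>

lemma orig_reduced_length:
  assumes "orig_length_constraints N \<delta> i j f \<alpha>" "\<forall>a\<in>pair_arcs N i j. f a \<in> {0, 1}"
  shows "(\<Sum>a\<in>pair_arcs N i j. f a * (len N (und a) - \<delta> (und a))) \<le> radius N"
proof -
  have "f a * (len N (und a) - \<delta> (und a)) \<le> \<alpha> a" if "a \<in> pair_arcs N i j" for a
  proof -
    have "f a = 0 \<or> f a = 1"
      using assms(2) that by simp
    moreover have "f a * len N (und a) - \<delta> (und a) \<le> \<alpha> a" "0 \<le> \<alpha> a"
      using assms(1) that by (simp_all add: orig_length_constraints_def)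
    ultimately show ?thesis
      by auto
  qed
  then have "(\<Sum>a\<in>pair_arcs N i j. f a * (len N (und a) - \<delta> (und a))) \<le> (\<Sum>a\<in>pair_arcs N i j. \<alpha> a)"
    by (rule sum_mono)
  with assms show ?thesis
    by (simp add: orig_length_constraints_def)
qed

text \<open>
  The bound \<open>\<gamma>\<^sub>a \<le> u f\<^sub>a\<close> allows a reduction only on arcs that carry flow, so \<open>\<gamma>\<^sub>a \<le> f\<^sub>a \<delta>\<^sub>e\<close>.
\<close>

lemma alt_reduced_length:
  assumes "alt_length_constraints N \<delta> i j f \<gamma>" "\<forall>a\<in>pair_arcs N i j. f a \<in> {0, 1}"
  shows "(\<Sum>a\<in>pair_arcs N i j. f a * (len N (und a) - \<delta> (und a))) \<le> radius N"
proof -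
  have "f a * (len N (und a) - \<delta> (und a)) \<le> f a * len N (und a) - \<gamma> a" if "a \<in> pair_arcs N i j" for a
    using assms that by (cases "f a = 0") (auto simp: alt_length_constraints_def)
  then have "(\<Sum>a\<in>pair_arcs N i j. f a * (len N (und a) - \<delta> (und a)))
      \<le> (\<Sum>a\<in>pair_arcs N i j. f a * len N (und a) - \<gamma> a)"
    by (rule sum_mono)
  with assms show ?thesis
    by (simp add: alt_length_constraints_def)
qed

text \<open>
  If \<open>i\<close> is served from \<open>j\<close>, then \<open>j\<close> holds a facility, which already exhausts the covering
  constraint of \<open>j\<close>.
\<close>

lemma base_constraints_not_mutual:
  assumes base: "base_constraints N {} x y \<delta>"
    and ij: "i \<in> nodes N" "j \<in> nodes N" "i \<noteq> j" and y: "y i j = 1"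
  shows "y j i = 0"
proof -
  have y_nonneg: "0 \<le> y k q" if "(k, q) \<in> y_index N {}" for k q
    using base that by (fastforce simp: base_constraints_def)
  have "x j \<in> {0, 1}" "y i j \<le> x j" "covered N {} x y j \<le> 1"
    using base ij by (auto simp: base_constraints_def y_index_def)
  then have "(\<Sum>k | (j, k) \<in> y_index N {}. y j k) \<le> 0"
    using y by (auto simp: covered_def)
  moreover have "finite {k. (j, k) \<in> y_index N {}}"
    by (rule finite_subset[OF _ finite_nodes[of N]]) (auto simp: y_index_def)
  moreover have ji: "(j, i) \<in> y_index N {}"
    using ij by (auto simp: y_index_def)
  ultimately have "y j i \<le> 0"
    using member_le_sum[of i "{k. (j, k) \<in> y_index N {}}" "y j"] y_nonneg by auto
  with y_nonneg[OF ji] show ?thesis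
    by simp
qed

section \<open>Removing pairs that carry no flow\<close>

lemma covered_cong:
  assumes "P \<subseteq> {(i, j). i \<in> nodes N \<and> j \<in> nodes N \<and> i < j}"
    and zero: "\<And>k q. (k, q) \<in> P \<or> (q, k) \<in> P \<Longrightarrow> y k q = 0"
  shows "covered N P x y i = covered N {} x y i"
proof -
  have "finite {j. (i, j) \<in> y_index N {}}"
    by (rule finite_subset[OF _ finite_nodes[of N]]) (auto simp: y_index_def)
  then have "(\<Sum>j | (i, j) \<in> y_index N P. y i j) = (\<Sum>j | (i, j) \<in> y_index N {}. y i j)"
    by (intro sum.mono_neutral_left) (auto simp: y_index_def zero)
  then show ?thesis
    by (simp add: covered_def)
qed

lemma flow_constraints_zero:
  assumes "y i j = 0" "y j i = 0"
  shows "flow_constraints N y i j (\<lambda>_. 0)"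
  using assms by (simp add: flow_constraints_def)

lemma flow_constraints_cong:
  assumes "y i j = y' i j" "y j i = y' j i"
  shows "flow_constraints N y i j f = flow_constraints N y' i j f"
  using assms by (simp add: flow_constraints_def)

text \<open>
  The constraints that are deleted hold trivially for vanishing \<open>y\<close>; for \<open>y\<^sub>k\<^sub>q \<le> x\<^sub>q\<close> this uses that
  \<open>x\<close> is nonnegative.
\<close>

lemma base_constraints_cong:
  assumes P: "P \<subseteq> {(i, j). i \<in> nodes N \<and> j \<in> nodes N \<and> i < j}"
    and zero: "\<And>k q. (k, q) \<in> P \<or> (q, k) \<in> P \<Longrightarrow> y k q = 0"
    and x: "\<And>q. q \<in> nodes N \<Longrightarrow> x q \<in> {0, 1}"
  shows "base_constraints N P x y \<delta> \<longleftrightarrow> base_constraints N {} x y \<delta>"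
proof -
  have "(\<forall>(k, q)\<in>y_index N P. y k q \<le> x q) \<longleftrightarrow> (\<forall>(k, q)\<in>y_index N {}. y k q \<le> x q)"
    using zero x by (fastforce simp: y_index_def)
  moreover have "(\<forall>(k, q)\<in>y_index N P. y k q \<in> {0, 1}) \<longleftrightarrow> (\<forall>(k, q)\<in>y_index N {}. y k q \<in> {0, 1})"
    using zero by (fastforce simp: y_index_def)
  ultimately show ?thesis
    by (simp add: base_constraints_def covered_cong[OF P zero])
qed

lemma covered_depends_on_index:
  assumes "\<And>k q. (k, q) \<in> y_index N P \<Longrightarrow> y k q = y' k q"
  shows "covered N P x y i = covered N P x y' i"
  using assms by (auto simp: covered_def intro!: sum.cong)

text \<open>
  The parameter \<open>pair_ok\<close> stands for the length constraints of a pair, in which the two versions of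
  the program differ. What matters about them is that they bound the reduced length of a \<open>0\<close>-\<open>1\<close> flow
  and that they admit the zero solution.
\<close>

lemma removal_preserves_objective_values:
  fixes N :: network
    and pair_ok :: "(nat set \<Rightarrow> real) \<Rightarrow> nat \<Rightarrow> nat \<Rightarrow> (nat \<times> nat \<Rightarrow> real) \<Rightarrow> (nat \<times> nat \<Rightarrow> real) \<Rightarrow> bool"
  defines "feasible \<equiv> \<lambda>Q x y \<delta> f g. base_constraints N Q x y \<delta> \<and>
     (\<forall>(i, j)\<in>pair_index N Q. pair_ok \<delta> i j (f i j) (g i j) \<and> flow_constraints N y i j (f i j))"
  assumes N: "valid_network N"
    and P: "P \<subseteq> {(i, j). i \<in> nodes N \<and> j \<in> nodes N \<and> i < j}"
    and no_flow: "\<And>i j \<delta> f. (i, j) \<in> P \<Longrightarrow> red_feasible N \<delta> \<Longrightarrow> \<not> covering_flow N \<delta> i j f"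
    and len: "\<And>\<delta> i j f g. pair_ok \<delta> i j f g \<Longrightarrow> \<forall>a\<in>pair_arcs N i j. f a \<in> {0, 1} \<Longrightarrow>
      (\<Sum>a\<in>pair_arcs N i j. f a * (len N (und a) - \<delta> (und a))) \<le> radius N"
    and zero_ok: "\<And>\<delta> i j. red_feasible N \<delta> \<Longrightarrow> pair_ok \<delta> i j (\<lambda>_. 0) (\<lambda>_. 0)"
  shows "{ereal (objective N P x y) | x y \<delta> f g. feasible P x y \<delta> f g}
       = {ereal (objective N {} x y) | x y \<delta> f g. feasible {} x y \<delta> f g}" (is "?L = ?R")
proof (intro subset_antisym subsetI)
  fix v assume "v \<in> ?L"
  then obtain x y \<delta> f g where v: "v = ereal (objective N P x y)" and feas: "feasible P x y \<delta> f g"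
    by blast
  define y' where "y' k q = (if (k, q) \<in> P \<or> (q, k) \<in> P then 0 else y k q)" for k q
  define f' where "f' k q = (if (k, q) \<in> P then (\<lambda>_. 0) else f k q)" for k q
  define g' where "g' k q = (if (k, q) \<in> P then (\<lambda>_. 0) else g k q)" for k q
  have base: "base_constraints N P x y \<delta>"
    using feas by (simp add: feasible_def)
  then have \<delta>: "red_feasible N \<delta>" and x: "\<And>q. q \<in> nodes N \<Longrightarrow> x q \<in> {0, 1}"
    by (auto simp: base_constraints_def)
  have agree: "y' k q = y k q" if "(k, q) \<in> y_index N P" for k q
    using that by (simp add: y'_def y_index_def)
  have zero: "y' k q = 0" if "(k, q) \<in> P \<or> (q, k) \<in> P" for k q
    using that by (simp add: y'_def)
  have cov: "covered N P x y' i = covered N P x y i" for i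
    by (intro covered_depends_on_index agree)
  have "base_constraints N P x y' \<delta>"
    using base agree by (auto simp: base_constraints_def cov)
  then have "base_constraints N {} x y' \<delta>"
    by (simp only: base_constraints_cong[OF P zero x])
  moreover have "pair_ok \<delta> i j (f' i j) (g' i j) \<and> flow_constraints N y' i j (f' i j)"
    if ij: "(i, j) \<in> pair_index N {}" for i j
  proof (cases "(i, j) \<in> P")
    case True
    then show ?thesis
      using zero_ok[OF \<delta>] by (auto simp: f'_def g'_def zero intro!: flow_constraints_zero)
  next
    case False
    then have ij_P: "(i, j) \<in> pair_index N P"
      using ij by (simp add: pair_index_def)
    have "(j, i) \<notin> P"
      using ij P by (auto simp: pair_index_def)
    with False have "flow_constraints N y' i j (f i j) = flow_constraints N y i j (f i j)"
      by (intro flow_constraints_cong) (simp_all add: y'_def)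
    then show ?thesis
      using feas ij_P False by (auto simp: feasible_def f'_def g'_def)
  qed
  ultimately have "feasible {} x y' \<delta> f' g'"
    by (auto simp: feasible_def)
  moreover have "v = ereal (objective N {} x y')"
    by (simp add: v objective_def cov covered_cong[OF P zero, symmetric])
  ultimately show "v \<in> ?R"
    by blast
next
  fix v assume "v \<in> ?R"
  then obtain x y \<delta> f g where v: "v = ereal (objective N {} x y)" and feas: "feasible {} x y \<delta> f g"
    by blast
  then have base: "base_constraints N {} x y \<delta>"
    by (simp add: feasible_def)
  then have \<delta>: "red_feasible N \<delta>" and x: "\<And>q. q \<in> nodes N \<Longrightarrow> x q \<in> {0, 1}"
    by (auto simp: base_constraints_def)
  have pair_zero: "y i j = 0 \<and> y j i = 0" if "(i, j) \<in> P" for i j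
  proof (rule ccontr)
    assume nz: "\<not> (y i j = 0 \<and> y j i = 0)"
    have ij: "i \<in> nodes N" "j \<in> nodes N" "i \<noteq> j" "(i, j) \<in> pair_index N {}"
      using P that by (auto simp: pair_index_def)
    have "y i j \<in> {0, 1}" "y j i \<in> {0, 1}"
      using base ij by (auto simp: base_constraints_def y_index_def)
    with nz base_constraints_not_mutual[OF base] ij have "y i j + y j i = 1"
      by fastforce
    moreover have flow: "flow_constraints N y i j (f i j)" and ok: "pair_ok \<delta> i j (f i j) (g i j)"
      using feas ij(4) by (auto simp: feasible_def)
    moreover have "\<forall>a\<in>pair_arcs N i j. f i j a \<in> {0, 1}"
      using flow by (simp add: flow_constraints_def)
    ultimately have "covering_flow N \<delta> i j (\<lambda>a. if a \<in> pair_arcs N i j then f i j a else 0)"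
      using covering_flow_of_pair_flow[OF N ij(1-3) flow] len by blast
    with no_flow[OF that \<delta>] show False
      by blast
  qed
  then have zero: "y k q = 0" if "(k, q) \<in> P \<or> (q, k) \<in> P" for k q
    using that by blast
  have "base_constraints N P x y \<delta>"
    using base by (simp only: base_constraints_cong[OF P zero x])
  then have "feasible P x y \<delta> f g"
    using feas by (auto simp: feasible_def pair_index_def)
  moreover have "v = ereal (objective N P x y)"
    by (simp add: v objective_def covered_cong[OF P zero])
  ultimately show "v \<in> ?L"
    by blast
qed

lemma orig_length_constraints_zero:
  assumes N: "valid_network N" and \<delta>: "red_feasible N \<delta>"
  shows "orig_length_constraints N \<delta> i j (\<lambda>_. 0) (\<lambda>_. 0)"
proof -
  have "0 \<le> \<delta> (und a)" "0 \<le> len N (und a) - \<delta> (und a)" if "a \<in> pair_arcs N i j" for a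
  proof -
    have a: "a \<in> arcs (digr N)"
      using that by (simp add: pair_arcs_def)
    show "0 \<le> \<delta> (und a)"
      using \<delta> und_in_edges[OF a] by (simp add: red_feasible_def)
    show "0 \<le> len N (und a) - \<delta> (und a)"
      using reduced_length_pos[OF N \<delta> a] by simp
  qed
  then show ?thesis
    using N by (simp add: orig_length_constraints_def valid_network_def)
qed

lemma alt_length_constraints_zero:
  assumes N: "valid_network N" and \<delta>: "red_feasible N \<delta>"
  shows "alt_length_constraints N \<delta> i j (\<lambda>_. 0) (\<lambda>_. 0)"
proof -
  have "0 \<le> \<delta> (und a)" if "a \<in> pair_arcs N i j" for a
    using \<delta> und_in_edges[of a N] that by (simp add: red_feasible_def pair_arcs_def)
  then show ?thesis
    using N by (simp add: alt_length_constraints_def valid_network_def)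
qed

section \<open>Removal of redundant pairs\<close>

theorem proposition2:
  fixes N :: network
    and es :: "nat \<Rightarrow> nat set"
    and \<sigma> :: "nat \<Rightarrow> nat"
    and P :: "(nat \<times> nat) set"
  assumes "valid_network N"
    and "bij_betw es {1..card (edges N)} (edges N)"
    and "\<sigma> permutes {1..card (edges N)}"
    and "mono_on {1..card (edges N)} (\<lambda>k. cost N (es (\<sigma> k)))"
    and "P \<subseteq> {(i, j). i \<in> nodes N \<and> j \<in> nodes N \<and> i < j}"
    and "\<And>i j. (i, j) \<in> P \<Longrightarrow>
           cond_i N i j \<or> cond_ii N i j \<or> cond_iii N es \<sigma> i j \<or> cond_iv N i j"
  shows "flow_cov_value N P = flow_cov_value N {} \<and>
         alt_flow_cov_value N P = alt_flow_cov_value N {}"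
proof -
  have no_flow: "\<not> covering_flow N \<delta> i j f" if "(i, j) \<in> P" "red_feasible N \<delta>" for i j \<delta> f
  proof
    assume f: "covering_flow N \<delta> i j f"
    have i: "i \<in> nodes N"
      using assms(5) that(1) by blast
    show False
      using assms(6)[OF that(1)] not_cond_i[OF assms(1) that(2) f i] not_cond_ii[OF assms(1) that(2) f i]
        not_cond_iii[OF assms(1) that(2) f i assms(2-4)] not_cond_iv[OF assms(1) that(2) f]
      by blast
  qed
  show ?thesis
    unfolding flow_cov_value_def alt_flow_cov_value_def flow_cov_feasible_def alt_flow_cov_feasible_def
    using removal_preserves_objective_values[where pair_ok = "orig_length_constraints N",
        OF assms(1,5) no_flow orig_reduced_length orig_length_constraints_zero[OF assms(1)]]
      removal_preserves_objective_values[where pair_ok = "alt_length_constraints N",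
        OF assms(1,5) no_flow alt_reduced_length alt_length_constraints_zero[OF assms(1)]]
    by simp
qed

end
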